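(* The equation $x+y=z$ is $3$-uncommon over $\mathbb{Z}_n$.
   Context: $\mathbb{Z}_n$ denotes the integers modulo $n$. A $3$-coloring of $\mathbb{Z}_n$ is a surjective function $f:\mathbb{Z}_n\to\{1,2,3\}$ (so $n\ge3$ is understood). The solutions of $x+y=z$ over $\mathbb{Z}_n$ are the ordered triples $(x,y,z)\in\mathbb{Z}_n^3$ with $x+y=z$ in $\mathbb{Z}_n$ (entries need not be distinct). A solution is monochromatic under $f$ if $f(x)=f(y)=f(z)$. Let $m_n$ denote the minimum, over all $3$-colorings $f$ of $\mathbb{Z}_n$, of the number of monochromatic solutions divided by the total number of solutions. The equation is $3$-uncommon over $\mathbb{Z}_n$ if this minimum proportion is asymptotically strictly less than $\frac19$ (the asymptotic expected proportion of monochromatic solutions in a uniformly random $3$-coloring), i.e. $\limsup_{n\to\infty} m_n<\frac19$. *)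

theory Defs
  imports Complex_Main "HOL-Number_Theory.Residues" "HOL-Library.FuncSet"
    "HOL-Library.Liminf_Limsup" "HOL-Library.Extended_Real"
begin

abbreviation Zmod :: "nat \<Rightarrow> int ring" where
  "Zmod n \<equiv> residue_ring (int n)"

(* Functions are taken extensional outside the carrier, so that the set of colorings
   is finite; it is empty for n < 3. *)
definition three_colorings :: "nat \<Rightarrow> (int \<Rightarrow> nat) set" where
  "three_colorings n =
     {f \<in> carrier (Zmod n) \<rightarrow>\<^sub>E {1, 2, 3}. f ` carrier (Zmod n) = {1, 2, 3}}"

definition schur_solutions :: "nat \<Rightarrow> (int \<times> int \<times> int) set" where
  "schur_solutions n =
     {(x, y, z). x \<in> carrier (Zmod n) \<and> y \<in> carrier (Zmod n) \<and> z \<in> carrier (Zmod n)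
        \<and> x \<oplus>\<^bsub>Zmod n\<^esub> y = z}"

definition mono_solutions :: "nat \<Rightarrow> (int \<Rightarrow> nat) \<Rightarrow> (int \<times> int \<times> int) set" where
  "mono_solutions n f = {(x, y, z) \<in> schur_solutions n. f x = f y \<and> f y = f z}"

definition mono_proportion :: "nat \<Rightarrow> (int \<Rightarrow> nat) \<Rightarrow> real" where
  "mono_proportion n f = real (card (mono_solutions n f)) / real (card (schur_solutions n))"

(* Meaningful for n >= 3 only; for smaller n it is the unspecified minimum of the empty set. *)
definition min_mono_proportion :: "nat \<Rightarrow> real" where
  "min_mono_proportion n = Min (mono_proportion n ` three_colorings n)"

(* The limsup is taken in the extended reals; it ignores the finitely many n < 3. *)
definition schur_three_uncommon :: bool where
  "schur_three_uncommon \<longleftrightarrow> limsup (\<lambda>n. ereal (min_mono_proportion n)) < ereal (1 / 9)"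

end

theory Submission imports Defs begin

text \<open>Cut the circle into six equal half-open arcs and group them into three color classes: the
  two arcs around 0, the two arcs around 1/2, and the two remaining arcs. The last two classes are
  sum-free. The first class has density 1/3, so it contributes at most \<open>1/9\<close> of all solutions,
  and strictly less because two elements of its upper quarter sum to something outside it.\<close>

text \<open>Arc bounds are multiplied out by 6, so rounding enters only when elements are counted.
  The restricted lambda supplies the extensionality that \<open>three_colorings\<close>
  demands.\<close>

definition sixth_coloring :: "nat \<Rightarrow> int \<Rightarrow> nat" where
  "sixth_coloring n =
     (\<lambda>x\<in>{0..int n - 1}. if 6 * x < int n \<or> 5 * int n \<le> 6 * x then 1
        else if 2 * int n \<le> 6 * x \<and> 6 * x < 4 * int n then 3 else 2)"

lemma carrier_Zmod: "carrier (Zmod n) = {0..int n - 1}"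
  by (simp add: residue_ring_def)

lemma add_Zmod: "x \<oplus>\<^bsub>Zmod n\<^esub> y = (x + y) mod int n"
  by (simp add: residue_ring_def)

lemma schur_solutions_eq:
  assumes "n > 0"
  shows "schur_solutions n =
    (\<lambda>(x, y). (x, y, (x + y) mod int n)) ` ({0..int n - 1} \<times> {0..int n - 1})"
  using assms by (auto simp: schur_solutions_def carrier_Zmod add_Zmod image_iff)

text \<open>Lets solutions be counted as pairs, since the first two entries determine the
  third.\<close>

lemma inj_on_graph: "inj_on (\<lambda>(x, y). (x, y, g x y)) S"
  by (auto simp: inj_on_def)

lemma card_schur_solutions:
  assumes "n > 0"
  shows "card (schur_solutions n) = n\<^sup>2"
  using assms by (simp add: schur_solutions_eq card_image inj_on_graph power2_eq_square)

lemma sixth_coloring_in_three_colorings: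
  assumes "n \<ge> 6"
  shows "sixth_coloring n \<in> three_colorings n"
proof -
  let ?f = "sixth_coloring n" and ?C = "{0..int n - 1}"
  have "?f \<in> ?C \<rightarrow>\<^sub>E {1, 2, 3}"
    by (auto simp: sixth_coloring_def PiE_iff extensional_def)
  \<comment> \<open>The witnesses are 0 and the ceilings of n/6 and n/3, the least elements of their
    arcs; n \<ge> 6 keeps the ceiling of n/6 below n/3.\<close>
  moreover have "?f 0 = 1" "?f ((int n + 5) div 6) = 2" "?f ((2 * int n + 5) div 6) = 3"
    using assms by (auto simp: sixth_coloring_def)
  moreover have "0 \<in> ?C" "(int n + 5) div 6 \<in> ?C" "(2 * int n + 5) div 6 \<in> ?C"
    using assms by auto
  ultimately have "?f \<in> ?C \<rightarrow>\<^sub>E {1, 2, 3}" "1 \<in> ?f ` ?C" "2 \<in> ?f ` ?C" "3 \<in> ?f ` ?C"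
    by (simp_all only:) (metis image_eqI)+
  then show ?thesis
    by (auto simp: three_colorings_def carrier_Zmod)
qed

lemma sixth_coloring_eq_1:
  assumes "x \<in> {0..int n - 1}"
  shows "sixth_coloring n x = 1 \<longleftrightarrow> 6 * x < int n \<or> 5 * int n \<le> 6 * x"
  using assms by (simp add: sixth_coloring_def)

lemma sixth_coloring_eq_3:
  assumes "x \<in> {0..int n - 1}"
  shows "sixth_coloring n x = 3 \<longleftrightarrow> 2 * int n \<le> 6 * x \<and> 6 * x < 4 * int n"
  using assms by (simp add: sixth_coloring_def)

text \<open>Replaces the modular sum by two linear cases, so that the arc inequalities become linear
  arithmetic.\<close>

lemma mod_sum_cases:
  fixes x y m :: int
  assumes "x \<in> {0..m - 1}" "y \<in> {0..m - 1}"
  shows "(x + y) mod m = x + y \<or> (x + y) mod m = x + y - m"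
proof (cases "x + y < m")
  case False
  then have "(x + y - m) mod m = x + y - m"
    using assms by (intro mod_pos_pos_trivial) auto
  then show ?thesis by simp
qed (use assms in auto)

lemma mono_solutions_sixth_coloring:
  assumes "n > 0"
  defines "A \<equiv> {x \<in> {0..int n - 1}. 6 * x < int n \<or> 5 * int n \<le> 6 * x}"
  defines "B \<equiv> {x. int n \<le> 12 * x \<and> 6 * x < int n}"
  shows "mono_solutions n (sixth_coloring n)
    \<subseteq> (\<lambda>(x, y). (x, y, (x + y) mod int n)) ` (A \<times> A - B \<times> B)"
proof -
  have "(x, y) \<in> A \<times> A - B \<times> B"
    if xy: "x \<in> {0..int n - 1}" "y \<in> {0..int n - 1}"
      and mono: "sixth_coloring n x = sixth_coloring n y"
        "sixth_coloring n y = sixth_coloring n ((x + y) mod int n)" for x y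
  proof -
    define z where "z = (x + y) mod int n"
    have z: "z \<in> {0..int n - 1}"
      using assms(1) by (simp add: z_def)
    have sum: "z = x + y \<or> z = x + y - int n"
      using mod_sum_cases[OF xy] by (simp add: z_def)
    show ?thesis
    proof (cases "sixth_coloring n x = 1")
      case True
      then have one: "6 * u < int n \<or> 5 * int n \<le> 6 * u" if "u \<in> {x, y, z}" for u
        using that xy z mono sixth_coloring_eq_1[of u n] by (auto simp: z_def)
      \<comment> \<open>For x, y in [n/12, n/6) the sum lies in [n/6, n/3): it does not wrap around
        and misses color 1.\<close>
      have "\<not> (x \<in> B \<and> y \<in> B)"
        using one[of z] sum z unfolding B_def by simp linarith
      then show ?thesis
        using xy one[of x] one[of y] by (simp add: A_def)
    next
      case False
      show ?thesis
      proof (cases "sixth_coloring n x = 3")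
        case True
        then have three: "2 * int n \<le> 6 * u \<and> 6 * u < 4 * int n" if "u \<in> {x, y, z}" for u
          using that xy z mono sixth_coloring_eq_3[of u n] by (auto simp: z_def)
        \<comment> \<open>Contradiction: x + y lies in [2n/3, 4n/3), which modulo n is disjoint from
          the middle third.\<close>
        show ?thesis
          using three[of x] three[of y] three[of z] sum by simp
      next
        case not_three: False
        have two: "int n \<le> 6 * u \<and> 6 * u < 2 * int n \<or> 4 * int n \<le> 6 * u \<and> 6 * u < 5 * int n"
          if "u \<in> {x, y, z}" for u
        proof -
          have u: "u \<in> {0..int n - 1}" "sixth_coloring n u = sixth_coloring n x"
            using that xy z mono unfolding z_def by auto
          then show ?thesis
            using False not_three sixth_coloring_eq_1[OF u(1)] sixth_coloring_eq_3[OF u(1)]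
            by linarith
        qed
        \<comment> \<open>Contradiction: two elements of the same arc sum into the middle third
          modulo n, and elements of different arcs sum into [5n/6, 7n/6), the class around
          0.\<close>
        show ?thesis
          using two[of x] two[of y] two[of z] sum by simp linarith
      qed
    qed
  qed
  then show ?thesis
    using assms(1) by (force simp: mono_solutions_def schur_solutions_eq)
qed

lemma card_mono_solutions_sixth_coloring:
  assumes "n \<ge> 12"
  shows "real (card (mono_solutions n (sixth_coloring n)))
    \<le> (real n / 3 + 1)\<^sup>2 - (real n / 12 - 1)\<^sup>2"
proof -
  define A where "A = {x \<in> {0..int n - 1}. 6 * x < int n \<or> 5 * int n \<le> 6 * x}"
  define B where "B = {x. int n \<le> 12 * x \<and> 6 * x < int n}"
  have A_eq: "A = {0..(int n - 1) div 6} \<union> {(5 * int n + 5) div 6..int n - 1}"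
    using assms by (auto simp: A_def)
  have B_eq: "B = {(int n + 11) div 12..(int n - 1) div 6}"
    by (auto simp: B_def)
  have fin: "finite A" "finite B" "B \<subseteq> A"
    using assms by (auto simp: A_eq B_eq)
  have "card A \<le> nat ((int n - 1) div 6 + 1) + nat (int n - (5 * int n + 5) div 6)"
    unfolding A_eq by (rule order_trans[OF card_Un_le]) simp
  \<comment> \<open>The two arcs contain the ceiling and the floor of n/6 many integers, so rounding
    costs at most 1 in total.\<close>
  then have "3 * card A \<le> n + 3"
    using assms by linarith
  then have A: "real (card A) \<le> real n / 3 + 1"
    by linarith
  have "card B = nat ((int n - 1) div 6 + 1 - (int n + 11) div 12)"
    by (simp add: B_eq)
  then have "n \<le> 12 * card B + 12"
    using assms by linarith
  then have B: "real n / 12 - 1 \<le> real (card B)"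
    by linarith
  have "card (mono_solutions n (sixth_coloring n))
      \<le> card ((\<lambda>(x, y). (x, y, (x + y) mod int n)) ` (A \<times> A - B \<times> B))"
    using mono_solutions_sixth_coloring[of n] assms fin
    by (intro card_mono) (auto simp: A_def B_def)
  also have "\<dots> = card (A \<times> A - B \<times> B)"
    by (rule card_image[OF inj_on_graph])
  also have "real \<dots> = (real (card A))\<^sup>2 - (real (card B))\<^sup>2"
    using fin by (subst card_Diff_subset)
      (auto simp: card_cartesian_product power2_eq_square of_nat_diff card_mono mult_mono)
  \<comment> \<open>Squaring the lower bound for \<open>card B\<close> is monotone because n \<ge>
    12 makes n/12 - 1 nonnegative.\<close>
  also have "\<dots> \<le> (real n / 3 + 1)\<^sup>2 - (real n / 12 - 1)\<^sup>2"
    using A B assms by (intro diff_mono power_mono) auto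
  finally show ?thesis by simp
qed

lemma min_mono_proportion_le:
  assumes "f \<in> three_colorings n"
  shows "min_mono_proportion n \<le> mono_proportion n f"
proof -
  have "finite (three_colorings n)"
    unfolding three_colorings_def carrier_Zmod
    by (rule finite_subset[OF _ finite_PiE[of "{0..int n - 1}" "\<lambda>_. {1, 2, 3}"]]) auto
  then show ?thesis
    using assms by (simp add: min_mono_proportion_def)
qed

text \<open>The counting bound expands to (1/9 - 1/144) n^2 + 5n/6. Half of the saving 1/144 is
  given up to absorb the linear term: 5n/6 \<le> n^2/288 holds from n = 240 on.\<close>

lemma min_mono_proportion_bound:
  assumes "n \<ge> 240"
  shows "min_mono_proportion n \<le> 1 / 9 - 1 / 288"
proof -
  have "240 * real n \<le> real n * real n"
    using assms by (intro mult_right_mono) auto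
  then have "(real n / 3 + 1)\<^sup>2 - (real n / 12 - 1)\<^sup>2 \<le> (1 / 9 - 1 / 288) * (real n)\<^sup>2"
    by (simp add: power2_eq_square algebra_simps)
  then have "mono_proportion n (sixth_coloring n) \<le> 1 / 9 - 1 / 288"
    using card_mono_solutions_sixth_coloring[of n] assms
    by (simp add: mono_proportion_def card_schur_solutions divide_le_eq)
  then show ?thesis
    using min_mono_proportion_le[OF sixth_coloring_in_three_colorings, of n] assms by simp
qed

theorem theorem1p2: "schur_three_uncommon"
proof -
  have "limsup (\<lambda>n. ereal (min_mono_proportion n)) \<le> ereal (1 / 9 - 1 / 288)"
    by (intro Limsup_bounded eventually_sequentiallyI[of 240])
      (simp only: ereal_less_eq(3) min_mono_proportion_bound)
  also have "\<dots> < ereal (1 / 9)"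
    by simp
  finally show ?thesis
    unfolding schur_three_uncommon_def .
qed

end
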